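(* Every subset $S\subset\mathbb{N}$ is a weak interpolation set of all orders for the class of systems of finite topological entropy.
   Context: $\mathbb{N}=\{1,2,3,\ldots\}$ and $\mathbb{N}_0=\mathbb{N}\cup\{0\}$. A (topological dynamical) system is a pair $(X,T)$ where $X$ is a compact metric space and $T:X\to X$ is a continuous map (not necessarily invertible). A point $x\in X$ is transitive if its forward orbit $\{T^nx:n\in\mathbb{N}_0\}$ is dense in $X$. $C(X)$ denotes the continuous complex-valued functions on $X$. Let $\mathcal{C}$ be a class of systems and $k\in\mathbb{N}$. A set $S\subset\mathbb{N}$ is a weak interpolation set of order $k$ for $\mathcal{C}$ if for every $f:S\to\{0,\dots,k-1\}$ there exist $(X,T)\in\mathcal{C}$, a transitive point $x\in X$ and $F\in C(X)$ such that $F(T^nx)=f(n)$ for every $n\in S$. $S$ is a weak interpolation set of all orders for $\mathcal{C}$ if it is a weak interpolation set of order $k$ for $\mathcal{C}$ for every $k\in\mathbb{N}$. Topological entropy: let $\rho$ be the metric on $X$, $\rho_n(x,y)=\max_{0\leq k\leq n}\rho(T^kx,T^ky)$, and let $c(n,\varepsilon,T)$ be the smallest cardinality of a cover of $X$ by sets of $\rho_n$-diameter less than $\varepsilon$. The topological entropy of $(X,T)$ is $h(T)=\lim_{\varepsilon\to0^+}\lim_{n\to\infty}\frac{\log c(n,\varepsilon,T)}{n}\in[0,\infty]$. *)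

theory Defs
  imports "HOL-Analysis.Analysis"
begin

text \<open>A system \<open>(X, T)\<close> is a pair \<open>(m, T)\<close>, where the abstract metric \<open>m\<close> carries both the set \<open>X\<close>
  (as \<^term>\<open>mspace m\<close>) and its metric. Only the values of \<open>T\<close> on \<^term>\<open>mspace m\<close> matter.\<close>

definition topological_system :: "'a metric \<Rightarrow> ('a \<Rightarrow> 'a) \<Rightarrow> bool" where
  "topological_system m T \<longleftrightarrow>
     compact_space (mtopology_of m) \<and> continuous_map (mtopology_of m) (mtopology_of m) T"

definition transitive_point :: "'a metric \<Rightarrow> ('a \<Rightarrow> 'a) \<Rightarrow> 'a \<Rightarrow> bool" where
  "transitive_point m T x \<longleftrightarrow>
     x \<in> mspace m \<and> mtopology_of m closure_of range (\<lambda>n. (T ^^ n) x) = mspace m"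

definition bowen_dist :: "'a metric \<Rightarrow> ('a \<Rightarrow> 'a) \<Rightarrow> nat \<Rightarrow> 'a \<Rightarrow> 'a \<Rightarrow> real" where
  "bowen_dist m T n x y = (MAX k\<in>{0..n}. mdist m ((T ^^ k) x) ((T ^^ k) y))"

text \<open>The empty set gets diameter 0, as for the library constant \<^const>\<open>diameter\<close>.\<close>

definition bowen_diameter :: "'a metric \<Rightarrow> ('a \<Rightarrow> 'a) \<Rightarrow> nat \<Rightarrow> 'a set \<Rightarrow> real" where
  "bowen_diameter m T n U =
     (if U = {} then 0 else SUP (x, y) \<in> U \<times> U. bowen_dist m T n x y)"

definition bowen_cover :: "'a metric \<Rightarrow> ('a \<Rightarrow> 'a) \<Rightarrow> nat \<Rightarrow> real \<Rightarrow> 'a set set \<Rightarrow> bool" where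
  "bowen_cover m T n \<epsilon> \<U> \<longleftrightarrow>
     \<U> \<subseteq> Pow (mspace m) \<and> \<Union>\<U> = mspace m \<and> (\<forall>U\<in>\<U>. bowen_diameter m T n U < \<epsilon>)"

definition cover_number :: "'a metric \<Rightarrow> ('a \<Rightarrow> 'a) \<Rightarrow> nat \<Rightarrow> real \<Rightarrow> nat" where
  "cover_number m T n \<epsilon> = (LEAST c. \<exists>\<U>. finite \<U> \<and> bowen_cover m T n \<epsilon> \<U> \<and> card \<U> = c)"

definition topological_entropy :: "'a metric \<Rightarrow> ('a \<Rightarrow> 'a) \<Rightarrow> ereal" where
  "topological_entropy m T =
     Lim (at_right 0) (\<lambda>\<epsilon>. lim (\<lambda>n. ereal (ln (real (cover_number m T n \<epsilon>)) / real n)))"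

definition finite_entropy_systems :: "('a metric \<times> ('a \<Rightarrow> 'a)) set" where
  "finite_entropy_systems = {(m, T). topological_system m T \<and> topological_entropy m T < \<infinity>}"

text \<open>The values of \<open>f\<close> outside \<open>S\<close> are irrelevant, so \<open>f\<close> is a total function constrained on \<open>S\<close>.\<close>

definition weak_interpolation_set ::
    "('a metric \<times> ('a \<Rightarrow> 'a)) set \<Rightarrow> nat \<Rightarrow> nat set \<Rightarrow> bool" where
  "weak_interpolation_set \<C> k S \<longleftrightarrow>
     (\<forall>f \<in> S \<rightarrow> {0..<k}.
        \<exists>(m, T) \<in> \<C>. \<exists>x F. transitive_point m T x \<and>
          continuous_map (mtopology_of m) (euclidean :: complex topology) F \<and>
          (\<forall>n\<in>S. F ((T ^^ n) x) = of_nat (f n)))"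

definition weak_interpolation_set_all_orders ::
    "('a metric \<times> ('a \<Rightarrow> 'a)) set \<Rightarrow> nat set \<Rightarrow> bool" where
  "weak_interpolation_set_all_orders \<C> S \<longleftrightarrow> (\<forall>k\<ge>1. weak_interpolation_set \<C> k S)"

text \<open>One cannot quantify existentially over the type of points, so the class of all systems is
  represented by the systems whose points lie in one fixed type. The type \<^typ>\<open>nat \<Rightarrow> real\<close> loses
  nothing: any subset of it with any metric is allowed, and every system on any type
  is isometrically conjugate to such a system.\<close>

lemma topological_system_representation:
  fixes m :: "'a metric"
  assumes "topological_system m T"
  shows "\<exists>(m' :: (nat \<Rightarrow> real) metric) T' g. topological_system m' T' \<and>
           bij_betw g (mspace m) (mspace m') \<and>
           (\<forall>x\<in>mspace m. \<forall>y\<in>mspace m. mdist m' (g x) (g y) = mdist m x y) \<and>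
           (\<forall>x\<in>mspace m. T' (g x) = g (T x))"
proof -
  interpret M: Metric_space "mspace m" "mdist m" by simp
  define X where "X = mspace m"
  have cpt: "compact_space M.mtopology" and cont: "continuous_map M.mtopology M.mtopology T"
    using assms by (auto simp: topological_system_def mtopology_of_def)
  have TX: "T x \<in> X" if "x \<in> X" for x
    using continuous_map_funspace[OF cont] that unfolding X_def by auto
  have "M.mtotally_bounded X"
    using cpt M.compact_space_eq_mcomplete_mtotally_bounded X_def by blast
  then have "\<exists>K. finite K \<and> K \<subseteq> X \<and> X \<subseteq> (\<Union>x\<in>K. M.mball x (1 / real (Suc n)))" for n
    unfolding M.mtotally_bounded_def by simp
  then obtain K where K: "\<And>n. finite (K n)" "\<And>n. K n \<subseteq> X"
      "\<And>n. X \<subseteq> (\<Union>x\<in>K n. M.mball x (1 / real (Suc n)))"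
    by metis
  define D where "D = (\<Union>n. K n)"
  have cD: "countable D"
    unfolding D_def using K(1) by (auto intro: countable_finite)
  have dense: "\<exists>d\<in>D. mdist m d x < \<epsilon>" if x: "x \<in> X" and \<epsilon>: "\<epsilon> > 0" for x \<epsilon>
  proof -
    obtain n where n: "1 / real (Suc n) < \<epsilon>"
      using \<epsilon> nat_approx_posE by blast
    obtain d where "d \<in> K n" "x \<in> M.mball d (1 / real (Suc n))"
      using K(3)[of n] x by blast
    with n show ?thesis
      unfolding D_def by (intro bexI[of _ d]) auto
  qed
  define g :: "'a \<Rightarrow> nat \<Rightarrow> real" where "g x n = mdist m (from_nat_into D n) x" for x n
  have inj: "inj_on g X"
  proof (rule inj_onI, rule ccontr)
    fix x y assume xy: "x \<in> X" "y \<in> X" "g x = g y" "x \<noteq> y"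
    then have pos: "mdist m x y / 2 > 0"
      using X_def by (simp add: order_less_le)
    obtain d where d: "d \<in> D" "mdist m d x < mdist m x y / 2"
      using dense[OF xy(1) pos] by blast
    have dX: "d \<in> X"
      using d(1) K(2) by (auto simp: D_def)
    obtain n where "from_nat_into D n = d"
      using from_nat_into_surj[OF cD d(1)] by blast
    then have "mdist m d x = mdist m d y"
      using fun_cong[OF xy(3), of n] by (simp add: g_def)
    moreover have "mdist m x y \<le> mdist m d x + mdist m d y"
      using mdist_triangle[of x m d y] xy dX X_def mdist_commute[of m x d] by simp
    ultimately show False
      using d(2) by simp
  qed
  define h where "h = inv_into X g"
  have hg: "h (g x) = x" if "x \<in> X" for x
    using inj that by (simp add: h_def)
  define d' where "d' u v = mdist m (h u) (h v)" for u v
  interpret N: Metric_space "g ` X" d'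
    by unfold_locales
      (auto simp: d'_def hg X_def mdist_commute intro!: mdist_triangle)
  interpret MN: Metric_space12 "mspace m" "mdist m" "g ` X" d'
    by unfold_locales
  have iso: "homeomorphic_map M.mtopology N.mtopology g"
    by (rule MN.isometry_imp_homeomorphic_map) (auto simp: d'_def hg X_def[symmetric])
  interpret NM: Metric_space12 "g ` X" d' "mspace m" "mdist m"
    by unfold_locales
  have iso': "homeomorphic_map N.mtopology M.mtopology h"
    by (rule NM.isometry_imp_homeomorphic_map)
      (auto simp: d'_def hg X_def[symmetric] image_image)
  have "compact_space N.mtopology"
    using iso cpt homeomorphic_compact_space homeomorphic_map_imp_homeomorphic_space by blast
  moreover have "continuous_map N.mtopology N.mtopology (g \<circ> (T \<circ> h))"
    using iso iso' cont
    by (intro continuous_map_compose) (auto intro: homeomorphic_imp_continuous_map)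
  ultimately have "topological_system (metric (g ` X, d')) (g \<circ> (T \<circ> h))"
    by (simp add: topological_system_def)
  moreover have "bij_betw g (mspace m) (mspace (metric (g ` X, d')))"
    using inj by (simp add: bij_betw_def X_def[symmetric])
  ultimately show ?thesis
    by (intro exI[of _ "metric (g ` X, d')"] exI[of _ "g \<circ> (T \<circ> h)"] exI[of _ g])
      (auto simp: d'_def hg X_def[symmetric])
qed

end

theory Submission
  imports Defs
begin

text \<open>Given \<open>f\<close>, extend it by \<open>0\<close> to a sequence \<open>w\<close> and let the shift act on the closure \<open>X\<close> of
  the orbit of \<open>w\<close> in the space of all sequences. Then \<open>w\<close> is a transitive point by construction, and
  the letter at position \<open>0\<close> is a continuous function that reads off \<open>w n\<close> at the \<open>n\<close>-th point of the
  orbit. So every \<open>f\<close> is interpolated by a subshift over a finite alphabet; it remains to see that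
  such a system has finite entropy.

  With the ultrametric \<open>prefix_dist\<close>, two points have distance below \<open>\<epsilon>\<close> (for \<open>\<epsilon> \<le> 1\<close>) exactly if they agree
  on the first \<open>j\<close> letters, where \<open>j\<close> depends only on \<open>\<epsilon>\<close>, and they have Bowen distance below
  \<open>\<epsilon>\<close> exactly if they agree on the first \<open>n + j\<close> letters. Hence an optimal cover consists of
  cylinders, and the cover number is the number \<open>p (n + j)\<close> of words of length \<open>n + j\<close> that occur
  in \<open>X\<close> (\<open>cover_number_eq_card_words\<close>). Cutting a word in two shows
  \<open>p (m + n) \<le> p m * p n\<close> (\<open>card_words_add\<close>). By Fekete's lemma (\<open>fekete\<close>),
  \<open>ln (p n) / n\<close> converges to a real number, and so does \<open>ln (p (n + j)) / n\<close>, to the same limit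
  for every \<open>j\<close>. The entropy is this number (\<open>topological_entropy_orbit_closure\<close>).

  An upper bound on the cover numbers alone would not suffice: the entropy is defined by limits,
  which have no useful value unless they exist. This is why the growth rate is computed exactly.\<close>

section \<open>Subadditive sequences\<close>

text \<open>Fix \<open>m\<close> and divide \<open>n\<close> by \<open>m\<close> with remainder: \<open>a n\<close> exceeds \<open>n * (a m / m)\<close> by at
  most a constant, so \<open>a n / n\<close> is eventually below anything above \<open>a m / m\<close>. Nonnegativity
  bounds the quotients below, so that the infimum is a real number.\<close>

lemma fekete:
  fixes a :: "nat \<Rightarrow> real"
  assumes subadditive: "\<And>m n. a (m + n) \<le> a m + a n" and nonneg: "\<And>n. 0 \<le> a n"
  shows "(\<lambda>n. a n / real n) \<longlonglongrightarrow> (INF n\<in>{1..}. a n / real n)"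
    (is "_ \<longlonglongrightarrow> ?L")
proof (rule order_tendstoI)
  have bdd: "bdd_below ((\<lambda>n. a n / real n) ` {1..})"
    using nonneg by (auto intro!: bdd_belowI[of _ 0])
  fix b :: real
  {
    assume "b < ?L"
    then have "b < a n / real n" if "n \<ge> 1" for n
      using cINF_lower[OF bdd, of n] that by force
    then show "\<forall>\<^sub>F n in sequentially. b < a n / real n"
      by (auto simp: eventually_sequentially)
  next
    assume "?L < b"
    then obtain m where m: "m \<ge> 1" "a m / real m < b"
      using cINF_less_iff[OF _ bdd] by auto
    define C where "C = Max (a ` {..<m})"
    \<comment> \<open>The term \<open>a 0\<close> is needed for \<open>q = 0\<close>.\<close>
    have mult: "a (q * m) \<le> a 0 + real q * a m" for q
    proof (induction q)
      case (Suc q)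
      then show ?case
        using subadditive[of m "q * m"] by (simp add: algebra_simps)
    qed simp
    have bound: "a n / real n \<le> a m / real m + (a 0 + C) / real n" if "n \<ge> 1" for n
    proof -
      have "a n \<le> a (n div m * m) + a (n mod m)"
        using subadditive[of "n div m * m" "n mod m"] by simp
      also have "a (n mod m) \<le> C"
        unfolding C_def using m(1) by (intro Max_ge) auto
      also have "a (n div m * m) \<le> a 0 + real (n div m) * a m"
        by (rule mult)
      also have "real (n div m) * a m \<le> real n / real m * a m"
        using nonneg by (intro mult_right_mono of_nat_div_le_of_nat)
      finally have "a n \<le> real n * (a m / real m) + (a 0 + C)"
        by simp
      then show ?thesis
        using that by (simp add: field_simps)
    qed
    have "(\<lambda>n. a m / real m + (a 0 + C) / real n) \<longlonglongrightarrow> a m / real m + 0"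
      by (intro tendsto_intros lim_const_over_n)
    then have "\<forall>\<^sub>F n in sequentially. a m / real m + (a 0 + C) / real n < b"
      using m(2) by (intro order_tendstoD(2)[where y = "a m / real m + 0"]) simp_all
    with eventually_ge_at_top[of 1] show "\<forall>\<^sub>F n in sequentially. a n / real n < b"
      by eventually_elim (use bound in force)
  }
qed

section \<open>An ultrametric on sequences\<close>

text \<open>This metric induces the product topology of the discrete topology. It is chosen because its
  values are powers of \<open>1 / 2\<close> determined by the length of the common prefix, so that being
  \<open>\<epsilon>\<close>-close is the same as sharing a prefix of a length that depends only on \<open>\<epsilon>\<close>.\<close>

definition prefix_dist :: "(nat \<Rightarrow> 'b) \<Rightarrow> (nat \<Rightarrow> 'b) \<Rightarrow> real" where
  "prefix_dist x y = (if x = y then 0 else (1 / 2) ^ (LEAST i. x i \<noteq> y i))"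

lemma prefix_dist_nonneg: "0 \<le> prefix_dist x y"
  by (simp add: prefix_dist_def)

lemma prefix_dist_le_1: "prefix_dist x y \<le> 1"
  by (simp add: prefix_dist_def power_le_one)

lemma prefix_dist_le_iff: "prefix_dist x y \<le> (1 / 2) ^ n \<longleftrightarrow> (\<forall>i<n. x i = y i)"
proof (cases "x = y")
  case False
  then obtain i where i: "x i \<noteq> y i"
    by auto
  have "prefix_dist x y \<le> (1 / 2) ^ n \<longleftrightarrow> n \<le> (LEAST i. x i \<noteq> y i)"
    using False power_decreasing_iff[of "1 / 2 :: real" "LEAST i. x i \<noteq> y i" n]
    by (simp add: prefix_dist_def)
  also have "\<dots> \<longleftrightarrow> (\<forall>i<n. x i = y i)"
  proof
    assume "n \<le> (LEAST i. x i \<noteq> y i)"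
    then show "\<forall>i<n. x i = y i"
      by (auto dest: order_less_le_trans not_less_Least)
  next
    assume "\<forall>i<n. x i = y i"
    moreover have "x (LEAST i. x i \<noteq> y i) \<noteq> y (LEAST i. x i \<noteq> y i)"
      using i by (rule LeastI)
    ultimately show "n \<le> (LEAST i. x i \<noteq> y i)"
      by (meson not_less)
  qed
  finally show ?thesis .
qed (simp add: prefix_dist_def)

text \<open>The first property of \<open>j\<close> leaves a gap below \<open>\<epsilon>\<close>: it makes a supremum of distances below \<open>\<epsilon>\<close>
  stay strictly below \<open>\<epsilon>\<close>. The restriction \<open>\<epsilon> \<le> 1\<close> makes the prefix nonempty; only then do the
  prefixes of the first \<open>n\<close> shifts together form one prefix without gaps.\<close>

lemma prefix_dist_less_iff:
  assumes "0 < \<epsilon>" "\<epsilon> \<le> 1"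
  obtains j where "(1 / 2) ^ Suc j < \<epsilon>"
    "\<And>x y :: nat \<Rightarrow> 'b. prefix_dist x y < \<epsilon> \<longleftrightarrow> (\<forall>i<Suc j. x i = y i)"
proof -
  define k where "k = (LEAST k. (1 / 2) ^ k < \<epsilon>)"
  have ex: "\<exists>k. (1 / 2) ^ k < \<epsilon>"
    using assms(1) by (intro real_arch_pow_inv) auto
  have k: "(1 / 2) ^ k < \<epsilon>"
    unfolding k_def using ex by (rule LeastI_ex)
  then have "k \<noteq> 0"
    using assms(2) by (intro notI) simp
  then obtain j where j: "k = Suc j"
    using not0_implies_Suc by blast
  have "prefix_dist x y < \<epsilon> \<longleftrightarrow> prefix_dist x y \<le> (1 / 2) ^ k" for x y :: "nat \<Rightarrow> 'b"
  proof
    assume less: "prefix_dist x y < \<epsilon>"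
    show "prefix_dist x y \<le> (1 / 2) ^ k"
    proof (cases "x = y")
      case False
      with less have "k \<le> (LEAST i. x i \<noteq> y i)"
        unfolding k_def by (intro Least_le) (simp add: prefix_dist_def)
      with False show ?thesis
        by (simp add: prefix_dist_def power_decreasing)
    qed (simp add: prefix_dist_def)
  qed (use k in simp)
  with k show ?thesis
    by (intro that[of j]) (simp_all only: j prefix_dist_le_iff)
qed

lemma Metric_space_prefix_dist: "Metric_space X prefix_dist"
proof
  fix x y z :: "nat \<Rightarrow> 'b"
  show "0 \<le> prefix_dist x y"
    by (rule prefix_dist_nonneg)
  show "prefix_dist x y = prefix_dist y x"
    by (auto simp: prefix_dist_def eq_commute)
  show "prefix_dist x y = 0 \<longleftrightarrow> x = y"
    by (simp add: prefix_dist_def)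
  show "prefix_dist x z \<le> prefix_dist x y + prefix_dist y z"
  proof (cases "x = z")
    case True
    then show ?thesis
      by (simp add: prefix_dist_def)
  next
    case False
    \<comment> \<open>At the first position where \<open>x\<close> and \<open>z\<close> differ, \<open>y\<close> differs from one of them.\<close>
    define n where "n = (LEAST i. x i \<noteq> z i)"
    have "x n \<noteq> z n"
      unfolding n_def using False by (intro LeastI_ex[of "\<lambda>i. x i \<noteq> z i"]) auto
    then have "\<not> (\<forall>i<Suc n. x i = y i) \<or> \<not> (\<forall>i<Suc n. y i = z i)"
      by auto
    moreover have "(1 / 2) ^ n \<le> prefix_dist u v" if "\<not> (\<forall>i<Suc n. u i = v i)"
      for u v :: "nat \<Rightarrow> 'b"
    proof -
      from that obtain i where i: "i \<le> n" "u i \<noteq> v i"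
        by (auto simp: less_Suc_eq_le)
      then have "u \<noteq> v" "(LEAST i. u i \<noteq> v i) \<le> n"
        using Least_le[of "\<lambda>i. u i \<noteq> v i" i] by auto
      then show ?thesis
        by (simp add: prefix_dist_def power_decreasing)
    qed
    ultimately have "(1 / 2) ^ n \<le> prefix_dist x y \<or> (1 / 2) ^ n \<le> prefix_dist y z"
      by blast
    with False prefix_dist_nonneg[of x y] prefix_dist_nonneg[of y z] show ?thesis
      by (auto simp: prefix_dist_def[of x z] n_def)
  qed
qed

definition prefix_metric :: "(nat \<Rightarrow> 'b) set \<Rightarrow> (nat \<Rightarrow> 'b) metric" where
  "prefix_metric X = metric (X, prefix_dist)"

lemma mspace_prefix_metric [simp]: "mspace (prefix_metric X) = X"
  by (simp add: prefix_metric_def Metric_space.mspace_metric[OF Metric_space_prefix_dist])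

lemma mdist_prefix_metric [simp]: "mdist (prefix_metric X) = prefix_dist"
  by (simp add: prefix_metric_def Metric_space.mdist_metric[OF Metric_space_prefix_dist])

lemma mtopology_of_prefix_metric:
  "mtopology_of (prefix_metric X) = Metric_space.mtopology X prefix_dist"
  by (simp add: mtopology_of_def)

section \<open>The shift on an orbit closure\<close>

definition shift :: "(nat \<Rightarrow> 'b) \<Rightarrow> nat \<Rightarrow> 'b" where
  "shift x i = x (Suc i)"

lemma shift_funpow: "(shift ^^ n) x i = x (n + i)"
  by (induction n arbitrary: i) (simp_all add: shift_def)

text \<open>The closure of the forward orbit of \<open>w\<close> in the product topology, described by prefixes: a
  point lies in it if each of its prefixes occurs somewhere in \<open>w\<close>.\<close>

definition orbit_closure :: "(nat \<Rightarrow> 'b) \<Rightarrow> (nat \<Rightarrow> 'b) set" where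
  "orbit_closure w = {x. \<forall>n. \<exists>j. \<forall>i<n. x i = w (j + i)}"

definition words :: "(nat \<Rightarrow> 'b) set \<Rightarrow> nat \<Rightarrow> 'b list set" where
  "words X n = (\<lambda>x. map x [0..<n]) ` X"

text \<open>This is closedness of the orbit closure.\<close>

lemma orbit_closureI:
  assumes "\<And>n. \<exists>y\<in>orbit_closure w. \<forall>i<n. x i = y i"
  shows "x \<in> orbit_closure w"
  unfolding orbit_closure_def
proof (intro CollectI allI)
  fix n
  obtain y where y: "y \<in> orbit_closure w" "\<forall>i<n. x i = y i"
    using assms by blast
  from y(1) obtain j where "\<forall>i<n. y i = w (j + i)"
    unfolding orbit_closure_def by blast
  with y(2) show "\<exists>j. \<forall>i<n. x i = w (j + i)"
    by auto
qed

lemma funpow_shift_in_orbit_closure: "(shift ^^ n) w \<in> orbit_closure w"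
  by (auto simp: orbit_closure_def shift_funpow)

lemma shift_orbit_closure:
  assumes "x \<in> orbit_closure w"
  shows "shift x \<in> orbit_closure w"
  unfolding orbit_closure_def
proof (intro CollectI allI)
  fix n
  obtain j where "\<forall>i<Suc n. x i = w (j + i)"
    using assms unfolding orbit_closure_def by blast
  then have "\<forall>i<n. shift x i = w (Suc j + i)"
    by (auto simp: shift_def)
  then show "\<exists>j. \<forall>i<n. shift x i = w (j + i)" ..
qed

lemma words_orbit_closure_subset:
  "words (orbit_closure w) n \<subseteq> {xs. set xs \<subseteq> range w \<and> length xs = n}"
proof -
  have "x i \<in> range w" if x: "x \<in> orbit_closure w" for x i
  proof -
    obtain j where "\<forall>l<Suc i. x l = w (j + l)"
      using x unfolding orbit_closure_def by blast
    then show ?thesis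
      by auto
  qed
  then show ?thesis
    by (auto simp: words_def)
qed

lemma finite_words:
  assumes "finite (range w)"
  shows "finite (words (orbit_closure w) n)"
  using finite_subset[OF words_orbit_closure_subset finite_lists_length_eq[OF assms]] .

lemma card_words_pos:
  assumes "finite (range w)"
  shows "card (words (orbit_closure w) n) \<ge> 1"
proof -
  have "w \<in> orbit_closure w"
    using funpow_shift_in_orbit_closure[of 0 w] by simp
  then have "words (orbit_closure w) n \<noteq> {}"
    by (auto simp: words_def)
  with finite_words[OF assms] show ?thesis
    by (simp add: Suc_le_eq card_gt_0_iff)
qed

text \<open>A word is determined by its first \<open>m\<close> and its last \<open>n\<close> letters, and the latter form a word of
  the same set because the orbit closure is invariant under the shift.\<close>

lemma card_words_add:
  fixes w :: "nat \<Rightarrow> 'b"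
  assumes "finite (range w)"
  shows "card (words (orbit_closure w) (m + n))
    \<le> card (words (orbit_closure w) m) * card (words (orbit_closure w) n)"
proof -
  let ?W = "words (orbit_closure w)"
  have "(take m xs, drop m xs) \<in> ?W m \<times> ?W n" if xs: "xs \<in> ?W (m + n)" for xs
  proof -
    obtain x where x: "x \<in> orbit_closure w" "xs = map x [0..<m + n]"
      using xs unfolding words_def by blast
    have "(shift ^^ m) x \<in> orbit_closure w"
      using x(1) by (induction m) (auto intro: shift_orbit_closure)
    moreover have "drop m xs = map ((shift ^^ m) x) [0..<n]"
      by (auto simp: x(2) shift_funpow intro: nth_equalityI)
    moreover have "take m xs = map x [0..<m]"
      by (auto simp: x(2) intro: nth_equalityI)
    ultimately show ?thesis
      using x(1) by (auto simp: words_def)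
  qed
  moreover have "inj_on (\<lambda>xs :: 'b list. (take m xs, drop m xs)) (?W (m + n))"
    by (rule inj_onI) (metis append_take_drop_id prod.inject)
  ultimately have "card (?W (m + n)) \<le> card (?W m \<times> ?W n)"
    using finite_words[OF assms] by (intro card_inj_on_le) auto
  then show ?thesis
    by (simp add: card_cartesian_product)
qed

lemma word_eq_iff: "map x [0..<n] = map y [0..<n] \<longleftrightarrow> (\<forall>i<n. x i = y i)"
  by auto

section \<open>The orbit closure as a topological dynamical system\<close>

text \<open>A Cauchy sequence is eventually constant in each coordinate, which gives completeness. Finiteness
  of the alphabet enters through total boundedness: one point for each word of length \<open>k\<close>
  gives a \<open>(1 / 2) ^ k\<close>-net.\<close>

lemma compact_space_orbit_closure:
  fixes w :: "nat \<Rightarrow> 'b"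
  assumes "finite (range w)"
  shows "compact_space (mtopology_of (prefix_metric (orbit_closure w)))"
proof -
  interpret Metric_space "orbit_closure w" prefix_dist
    by (rule Metric_space_prefix_dist)
  have "mcomplete"
    unfolding mcomplete_def
  proof (intro allI impI)
    fix \<sigma> :: "nat \<Rightarrow> nat \<Rightarrow> 'b"
    assume \<sigma>: "MCauchy \<sigma>"
    then have ran: "\<sigma> n \<in> orbit_closure w" for n
      unfolding MCauchy_def by auto
    have "\<exists>N. \<forall>n\<ge>N. \<forall>i<k. \<sigma> n i = \<sigma> N i" for k
    proof -
      have "(1 / 2 :: real) ^ k > 0"
        by simp
      with \<sigma> obtain N where "\<forall>n n'. N \<le> n \<longrightarrow> N \<le> n' \<longrightarrow> prefix_dist (\<sigma> n) (\<sigma> n') < (1 / 2) ^ k"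
        unfolding MCauchy_def by blast
      then have "\<forall>n\<ge>N. prefix_dist (\<sigma> n) (\<sigma> N) \<le> (1 / 2) ^ k"
        by (meson less_imp_le order_refl)
      then show ?thesis
        by (auto simp: prefix_dist_le_iff)
    qed
    then obtain N where N: "\<And>k n i. n \<ge> N k \<Longrightarrow> i < k \<Longrightarrow> \<sigma> n i = \<sigma> (N k) i"
      by metis
    \<comment> \<open>From index \<open>N (Suc i)\<close> on, the letters at position \<open>i\<close> no longer change.\<close>
    define x where "x i = \<sigma> (N (Suc i)) i" for i
    have x: "\<sigma> n i = x i" if "n \<ge> N k" "i < k" for n k i
    proof -
      have "\<sigma> n i = \<sigma> (max (N k) (N (Suc i))) i"
        using N[of k n i] N[of k "max (N k) (N (Suc i))" i] that by simp
      also have "\<dots> = x i"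
        unfolding x_def by (intro N) auto
      finally show ?thesis .
    qed
    have "x \<in> orbit_closure w"
    proof (rule orbit_closureI)
      fix k
      show "\<exists>y\<in>orbit_closure w. \<forall>i<k. x i = y i"
        using x[of k "N k"] ran by (intro bexI[of _ "\<sigma> (N k)"]) auto
    qed
    moreover have "\<exists>N. \<forall>n\<ge>N. \<sigma> n \<in> orbit_closure w \<and> prefix_dist (\<sigma> n) x < \<epsilon>" if \<epsilon>: "\<epsilon> > 0" for \<epsilon>
    proof -
      obtain k where k: "(1 / 2) ^ k < \<epsilon>"
        using real_arch_pow_inv[OF \<epsilon>, of "1 / 2"] by auto
      have "prefix_dist (\<sigma> n) x \<le> (1 / 2) ^ k" if "n \<ge> N k" for n
        unfolding prefix_dist_le_iff using x that by blast
      with k ran show ?thesis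
        by (meson le_less_trans)
    qed
    ultimately have "limitin mtopology \<sigma> x sequentially"
      by (simp add: limit_metric_sequentially)
    then show "\<exists>x. limitin mtopology \<sigma> x sequentially"
      by blast
  qed
  moreover have "mtotally_bounded (orbit_closure w)"
    unfolding mtotally_bounded_def
  proof (intro allI impI)
    fix \<epsilon> :: real
    assume "\<epsilon> > 0"
    then obtain k where k: "(1 / 2) ^ k < \<epsilon>"
      using real_arch_pow_inv[of \<epsilon> "1 / 2"] by auto
    define g where "g = inv_into (orbit_closure w) (\<lambda>x. map x [0..<k])"
    let ?K = "g ` words (orbit_closure w) k"
    have gK: "?K \<subseteq> orbit_closure w"
      by (auto simp: g_def words_def intro: inv_into_into)
    have "x \<in> (\<Union>y\<in>?K. mball y \<epsilon>)" if x: "x \<in> orbit_closure w" for x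
    proof
      let ?v = "map x [0..<k]"
      have v: "?v \<in> words (orbit_closure w) k"
        unfolding words_def by (rule image_eqI[OF refl x])
      then show "g ?v \<in> ?K"
        by blast
      have "map (g ?v) [0..<k] = ?v"
        using f_inv_into_f[of ?v "\<lambda>x. map x [0..<k]"] v by (simp add: g_def words_def)
      then have "prefix_dist (g ?v) x \<le> (1 / 2) ^ k"
        by (simp only: prefix_dist_le_iff word_eq_iff)
      with k x gK v show "x \<in> mball (g ?v) \<epsilon>"
        by (auto simp: in_mball)
    qed
    with finite_words[OF assms] gK
    show "\<exists>K. finite K \<and> K \<subseteq> orbit_closure w \<and> orbit_closure w \<subseteq> (\<Union>x\<in>K. mball x \<epsilon>)"
      by (intro exI[of _ ?K]) auto
  qed
  ultimately show ?thesis
    by (simp add: mtopology_of_prefix_metric compact_space_eq_mcomplete_mtotally_bounded)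
qed

lemma topological_system_orbit_closure:
  assumes "finite (range w)"
  shows "topological_system (prefix_metric (orbit_closure w)) shift"
proof -
  interpret Metric_space "orbit_closure w" prefix_dist
    by (rule Metric_space_prefix_dist)
  have "\<exists>\<delta>>0. \<forall>y. y \<in> orbit_closure w \<and> prefix_dist x y < \<delta> \<longrightarrow> prefix_dist (shift x) (shift y) < \<epsilon>"
    if \<epsilon>: "\<epsilon> > 0" for x \<epsilon>
  proof -
    obtain k where k: "(1 / 2) ^ k < \<epsilon>"
      using real_arch_pow_inv[OF \<epsilon>, of "1 / 2"] by auto
    have "prefix_dist (shift x) (shift y) < \<epsilon>" if "prefix_dist x y < (1 / 2) ^ Suc k" for y
    proof -
      have "\<forall>i<Suc k. x i = y i"
        using that prefix_dist_le_iff less_imp_le by blast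
      then have "prefix_dist (shift x) (shift y) \<le> (1 / 2) ^ k"
        unfolding prefix_dist_le_iff by (simp add: shift_def)
      with k show ?thesis
        by linarith
    qed
    then show ?thesis
      by (intro exI[of _ "(1 / 2) ^ Suc k"]) auto
  qed
  then have "continuous_map mtopology mtopology shift"
    by (auto simp: metric_continuous_map[OF Metric_space_prefix_dist] shift_orbit_closure)
  with compact_space_orbit_closure[OF assms] show ?thesis
    by (simp add: topological_system_def mtopology_of_prefix_metric)
qed

lemma transitive_point_orbit_closure: "transitive_point (prefix_metric (orbit_closure w)) shift w"
proof -
  interpret Metric_space "orbit_closure w" prefix_dist
    by (rule Metric_space_prefix_dist)
  have "\<exists>n. prefix_dist x ((shift ^^ n) w) < r" if x: "x \<in> orbit_closure w" and r: "r > 0" for x r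
  proof -
    obtain k where k: "(1 / 2) ^ k < r"
      using real_arch_pow_inv[OF r, of "1 / 2"] by auto
    obtain n where "\<forall>i<k. x i = w (n + i)"
      using x unfolding orbit_closure_def by blast
    then have "prefix_dist x ((shift ^^ n) w) \<le> (1 / 2) ^ k"
      by (simp add: prefix_dist_le_iff shift_funpow)
    with k show ?thesis
      by (meson le_less_trans)
  qed
  then have "mtopology closure_of range (\<lambda>n. (shift ^^ n) w) = orbit_closure w"
    by (auto simp: metric_closure_of in_mball funpow_shift_in_orbit_closure)
  then show ?thesis
    using funpow_shift_in_orbit_closure[of 0 w]
    by (simp add: transitive_point_def mtopology_of_prefix_metric)
qed

text \<open>The first letter is locally constant, so it may be recoded by an arbitrary \<open>\<phi>\<close>.\<close>

lemma continuous_map_first_letter: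
  fixes \<phi> :: "'b \<Rightarrow> 'c :: topological_space"
  shows "continuous_map (mtopology_of (prefix_metric X)) euclidean (\<lambda>x. \<phi> (x 0))"
proof -
  interpret Metric_space X prefix_dist
    by (rule Metric_space_prefix_dist)
  have "openin mtopology {x \<in> X. \<phi> (x 0) \<in> U}" for U
    unfolding openin_mtopology
  proof (intro conjI allI impI)
    fix x
    assume x: "x \<in> {x \<in> X. \<phi> (x 0) \<in> U}"
    have "y 0 = x 0" if "y \<in> mball x (1 / 2)" for y
      using that prefix_dist_le_iff[of x y 1] by (auto simp: in_mball)
    with x show "\<exists>r>0. mball x r \<subseteq> {x \<in> X. \<phi> (x 0) \<in> U}"
      by (intro exI[of _ "1 / 2"]) (auto simp: in_mball)
  qed auto
  then show ?thesis
    by (auto simp: continuous_map_def mtopology_of_prefix_metric)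
qed

section \<open>Entropy as growth rate of the number of words\<close>

text \<open>The \<open>k\<close>-th shift contributes agreement on the window of positions \<open>k, \<dots>, k + j\<close>. The
  windows for \<open>k \<le> n\<close> are nonempty and so cover all positions up to \<open>n + j\<close>.\<close>

lemma bowen_dist_less_iff:
  assumes "\<And>x y :: nat \<Rightarrow> 'b. prefix_dist x y < \<epsilon> \<longleftrightarrow> (\<forall>i<Suc j. x i = y i)"
  shows "bowen_dist (prefix_metric X) shift n x y < \<epsilon> \<longleftrightarrow> (\<forall>i<n + Suc j. x i = (y i :: 'b))"
proof -
  have "bowen_dist (prefix_metric X) shift n x y < \<epsilon>
      \<longleftrightarrow> (\<forall>k\<le>n. \<forall>i<Suc j. x (k + i) = y (k + i))"
    by (auto simp: bowen_dist_def assms shift_funpow)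
  also have "\<dots> \<longleftrightarrow> (\<forall>i<n + Suc j. x i = y i)"
  proof safe
    fix i
    assume *: "\<forall>k\<le>n. \<forall>i<Suc j. x (k + i) = y (k + i)" and "i < n + Suc j"
    then show "x i = y i"
      using *[rule_format, of "min i n" "i - min i n"] by (cases "i \<le> n") auto
  qed auto
  finally show ?thesis .
qed

text \<open>The diameter is a supremum that need not be attained a priori; the gap between
  \<open>(1 / 2) ^ Suc j\<close> and \<open>\<epsilon>\<close> turns the pointwise strict inequality into one for the supremum.\<close>

lemma bowen_diameter_less_iff:
  fixes U :: "(nat \<Rightarrow> 'b) set"
  assumes "(1 / 2) ^ Suc j < \<epsilon>"
    and iff: "\<And>x y :: nat \<Rightarrow> 'b. prefix_dist x y < \<epsilon> \<longleftrightarrow> (\<forall>i<Suc j. x i = y i)"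
  shows "bowen_diameter (prefix_metric X) shift n U < \<epsilon>
    \<longleftrightarrow> (\<forall>x\<in>U. \<forall>y\<in>U. \<forall>i<n + Suc j. x i = y i)"
proof (cases "U = {}")
  case True
  then show ?thesis
    using iff[of x x for x] prefix_dist_nonneg le_less_trans
    by (fastforce simp: bowen_diameter_def)
next
  case False
  let ?d = "bowen_dist (prefix_metric X) shift n"
  have diam: "bowen_diameter (prefix_metric X) shift n U = (SUP (x, y) \<in> U \<times> U. ?d x y)"
    using False by (simp add: bowen_diameter_def)
  have bdd: "bdd_above ((\<lambda>(x, y). ?d x y) ` (U \<times> U))"
    by (auto intro!: bdd_aboveI[of _ 1] simp: bowen_dist_def prefix_dist_le_1)
  have "(SUP (x, y) \<in> U \<times> U. ?d x y) < \<epsilon> \<longleftrightarrow> (\<forall>x\<in>U. \<forall>y\<in>U. ?d x y < \<epsilon>)"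
  proof
    assume *: "(SUP (x, y) \<in> U \<times> U. ?d x y) < \<epsilon>"
    show "\<forall>x\<in>U. \<forall>y\<in>U. ?d x y < \<epsilon>"
      using cSUP_upper[OF _ bdd] * by fastforce
  next
    assume "\<forall>x\<in>U. \<forall>y\<in>U. ?d x y < \<epsilon>"
    then have "?d x y \<le> (1 / 2) ^ Suc j" if "x \<in> U" "y \<in> U" for x y
      using that iff unfolding bowen_dist_less_iff[OF iff]
      by (auto simp: bowen_dist_def shift_funpow prefix_dist_le_iff simp del: power_Suc)
    then have "(SUP (x, y) \<in> U \<times> U. ?d x y) \<le> (1 / 2) ^ Suc j"
      using False by (intro cSUP_least) auto
    with assms(1) show "(SUP (x, y) \<in> U \<times> U. ?d x y) < \<epsilon>"
      by simp
  qed
  then show ?thesis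
    by (simp add: diam bowen_dist_less_iff[OF iff])
qed

text \<open>The fibres of \<open>g\<close> are a cover of this kind, and no other is smaller since each member
  meets only one fibre. With \<open>g\<close> taking a sequence to its prefix of a given length, this
  counts words.\<close>

lemma least_card_cover_by_fibre_subsets:
  assumes fin: "finite (g ` X)"
  shows "(LEAST c. \<exists>\<U>. finite \<U> \<and> (\<U> \<subseteq> Pow X \<and> \<Union>\<U> = X \<and> (\<forall>U\<in>\<U>. \<forall>x\<in>U. \<forall>y\<in>U. g x = g y))
    \<and> card \<U> = c) = card (g ` X)"
proof (rule Least_equality)
  let ?\<U> = "(\<lambda>v. {x \<in> X. g x = v}) ` g ` X"
  have "inj_on (\<lambda>v. {x \<in> X. g x = v}) (g ` X)"
    by (auto intro!: inj_onI)
  then have "card ?\<U> = card (g ` X)"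
    by (rule card_image)
  with fin show "\<exists>\<U>. finite \<U> \<and> (\<U> \<subseteq> Pow X \<and> \<Union>\<U> = X
      \<and> (\<forall>U\<in>\<U>. \<forall>x\<in>U. \<forall>y\<in>U. g x = g y)) \<and> card \<U> = card (g ` X)"
    by (intro exI[of _ ?\<U>]) auto
next
  fix c
  assume "\<exists>\<U>. finite \<U> \<and> (\<U> \<subseteq> Pow X \<and> \<Union>\<U> = X
      \<and> (\<forall>U\<in>\<U>. \<forall>x\<in>U. \<forall>y\<in>U. g x = g y)) \<and> card \<U> = c"
  then obtain \<U> where \<U>: "finite \<U>" "\<Union>\<U> = X" "card \<U> = c"
    and const: "\<forall>U\<in>\<U>. \<forall>x\<in>U. \<forall>y\<in>U. g x = g y"
    by (elim exE conjE)
  have "\<forall>v\<in>g ` X. \<exists>U\<in>\<U>. \<exists>x\<in>U. g x = v"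
    using \<U>(2) by blast
  then obtain h where h: "\<And>v. v \<in> g ` X \<Longrightarrow> h v \<in> \<U> \<and> (\<exists>x\<in>h v. g x = v)"
    by metis
  have "inj_on h (g ` X)"
    by (rule inj_onI) (metis const h)
  then show "card (g ` X) \<le> c"
    using card_inj_on_le[of h "g ` X" \<U>] h \<U> by blast
qed

lemma cover_number_eq_card_words:
  fixes X :: "(nat \<Rightarrow> 'b) set"
  assumes "finite (words X (n + Suc j))" and "(1 / 2) ^ Suc j < \<epsilon>"
    and "\<And>x y :: nat \<Rightarrow> 'b. prefix_dist x y < \<epsilon> \<longleftrightarrow> (\<forall>i<Suc j. x i = y i)"
  shows "cover_number (prefix_metric X) shift n \<epsilon> = card (words X (n + Suc j))"
  using least_card_cover_by_fibre_subsets[OF assms(1)[unfolded words_def]]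
  unfolding cover_number_def bowen_cover_def bowen_diameter_less_iff[OF assms(2,3)]
    mspace_prefix_metric words_def word_eq_iff .

text \<open>The dependence on \<open>\<epsilon>\<close> is only a shift of the index \<open>n\<close> by a constant, which does not affect the
  growth rate. So the inner limit does not depend on \<open>\<epsilon> \<le> 1\<close>, and the outer limit is trivial.\<close>

lemma topological_entropy_orbit_closure:
  fixes w :: "nat \<Rightarrow> 'b"
  assumes "finite (range w)"
  shows "topological_entropy (prefix_metric (orbit_closure w)) shift
    = ereal (INF n\<in>{1..}. ln (card (words (orbit_closure w) n)) / n)"
proof -
  let ?m = "prefix_metric (orbit_closure w)"
  define a where "a n = ln (real (card (words (orbit_closure w) n)))" for n
  define L where "L = (INF n\<in>{1..}. a n / real n)"
  have pos: "real (card (words (orbit_closure w) n)) \<ge> 1" for n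
    using card_words_pos[OF assms, of n] by simp
  have "a (m + n) \<le> a m + a n" for m n
  proof -
    have "a (m + n) \<le> ln (real (card (words (orbit_closure w) m) * card (words (orbit_closure w) n)))"
      unfolding a_def using pos[of "m + n"] card_words_add[OF assms, of m n]
      by (intro ln_mono of_nat_mono) linarith+
    also have "\<dots> = a m + a n"
      using pos[of m] pos[of n] by (simp add: a_def ln_mult)
    finally show ?thesis .
  qed
  moreover have "a n \<ge> 0" for n
    using pos[of n] by (simp add: a_def)
  ultimately have lim_a: "(\<lambda>n. a n / real n) \<longlonglongrightarrow> L"
    unfolding L_def by (rule fekete)
  have "lim (\<lambda>n. ereal (ln (real (cover_number ?m shift n \<epsilon>)) / real n)) = ereal L"
    if \<epsilon>: "0 < \<epsilon>" "\<epsilon> \<le> 1" for \<epsilon>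
  proof (rule limI)
    obtain j where j: "(1 / 2) ^ Suc j < \<epsilon>"
      "\<And>x y :: nat \<Rightarrow> 'b. prefix_dist x y < \<epsilon> \<longleftrightarrow> (\<forall>i<Suc j. x i = y i)"
      using prefix_dist_less_iff[OF \<epsilon>] by blast
    have "(\<lambda>n. real (n + Suc j) / real n) \<longlonglongrightarrow> 1"
    proof -
      have "(\<lambda>n. 1 + real (Suc j) / real n) \<longlonglongrightarrow> 1 + 0"
        by (intro tendsto_intros lim_const_over_n)
      moreover have "\<forall>\<^sub>F n in sequentially. 1 + real (Suc j) / real n = real (n + Suc j) / real n"
        using eventually_gt_at_top[of 0] by eventually_elim (simp add: field_simps)
      ultimately show ?thesis
        by (simp add: filterlim_cong)
    qed
    then have "(\<lambda>n. a (n + Suc j) / real (n + Suc j) * (real (n + Suc j) / real n)) \<longlonglongrightarrow> L * 1"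
      by (intro tendsto_mult LIMSEQ_ignore_initial_segment[OF lim_a])
    then have "(\<lambda>n. a (n + Suc j) / real n) \<longlonglongrightarrow> L"
      by (simp del: of_nat_add add_Suc_right)
    then show "(\<lambda>n. ereal (ln (real (cover_number ?m shift n \<epsilon>)) / real n)) \<longlonglongrightarrow> ereal L"
      by (simp only: cover_number_eq_card_words[OF finite_words[OF assms] j] a_def lim_ereal)
  qed
  then have "\<forall>\<^sub>F \<epsilon> in at_right 0.
      lim (\<lambda>n. ereal (ln (real (cover_number ?m shift n \<epsilon>)) / real n)) = ereal L"
    unfolding eventually_at_right_field by (intro exI[of _ 1]) auto
  then have "((\<lambda>\<epsilon>. lim (\<lambda>n. ereal (ln (real (cover_number ?m shift n \<epsilon>)) / real n)))
      \<longlongrightarrow> ereal L) (at_right 0)"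
    by (rule tendsto_eventually)
  then show ?thesis
    unfolding topological_entropy_def L_def a_def
    by (intro tendsto_Lim) simp_all
qed

section \<open>Interpolation by subshifts\<close>

theorem proposition1p7:
  fixes S :: "nat set"
  assumes "S \<subseteq> {1..}"
  shows "weak_interpolation_set_all_orders
           (finite_entropy_systems :: ((nat \<Rightarrow> real) metric \<times> ((nat \<Rightarrow> real) \<Rightarrow> (nat \<Rightarrow> real))) set) S"
  unfolding weak_interpolation_set_all_orders_def weak_interpolation_set_def
proof (intro allI impI ballI)
  fix k :: nat and f
  assume f: "f \<in> S \<rightarrow> {0..<k}"
  define w :: "nat \<Rightarrow> real" where "w n = (if n \<in> S then real (f n) else 0)" for n
  let ?m = "prefix_metric (orbit_closure w)"
  have "range w \<subseteq> insert 0 (real ` {0..<k})"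
    using f by (auto simp: w_def)
  then have fin: "finite (range w)"
    by (rule finite_subset) simp
  have sys: "(?m, shift) \<in> finite_entropy_systems"
    by (simp add: finite_entropy_systems_def topological_system_orbit_closure[OF fin]
        topological_entropy_orbit_closure[OF fin])
  have "transitive_point ?m shift w"
    by (rule transitive_point_orbit_closure)
  moreover have "continuous_map (mtopology_of ?m) euclidean (\<lambda>x. complex_of_real (x 0))"
    by (rule continuous_map_first_letter)
  moreover have "\<forall>n\<in>S. complex_of_real ((shift ^^ n) w 0) = of_nat (f n)"
    by (simp add: shift_funpow w_def)
  ultimately have ex: "\<exists>x F. transitive_point ?m shift x \<and>
      continuous_map (mtopology_of ?m) (euclidean :: complex topology) F \<and>
      (\<forall>n\<in>S. F ((shift ^^ n) x) = of_nat (f n))"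
    by (intro exI conjI)
  show "\<exists>(m, T)\<in>finite_entropy_systems. \<exists>(x :: nat \<Rightarrow> real) F. transitive_point m T x \<and>
      continuous_map (mtopology_of m) (euclidean :: complex topology) F \<and>
      (\<forall>n\<in>S. F ((T ^^ n) x) = of_nat (f n))"
    by (rule bexI[OF _ sys], unfold prod.case, rule ex)
qed

end
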